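(* Consider the $\alpha$-discounted age-of-information Markov decision process with states $(E,K,C)$ described in the context, with optimal value function $J^*$. At any time $t$, the optimal policy exhibits a threshold structure on $p(C)$: there is a threshold function $p_{th}(E,K)$ of $E$ and $K$ such that, for any state $(E,K,C)$ with $E \geq E_s$, it is optimal to sample the source node if $p(C) \geq p_{th}(E,K)$.
   Context: Model. Fix integers $B\ge 1$ (energy buffer size) and $E_s\ge 1$ (energy cost of a sample), a discount factor $\alpha\in(0,1)$, an energy arrival rate $\lambda\in(0,1]$, finitely many channel states $C_1,\dots,C_m$ with occurrence probabilities $q_1,\dots,q_m\ge 0$, $\sum_j q_j=1$, and packet success probabilities $p(C_j)=p_j\in[0,1]$. The state space is $\mathcal S=\{0,1,\dots,B\}\times\mathbb Z_+\times\{C_1,\dots,C_m\}$; in a state $(E,K,C)$, $E$ is the available energy, $K$ the age of information, and $C$ the current channel state. The action set is $\{0,1\}$ ($a=1$: sample and transmit; $a=0$: stay idle); $a=1$ is allowed only if $E\ge E_s$. The single-stage costs are $c((E,K,C),0)=K$ and $c((E,K,C),1)=K(1-p(C))$. Transitions: let $A\sim\mathrm{Bernoulli}(\lambda)$ and let $C'$ be the next channel state, with $\mathbb P(C'=C_j)=q_j$, both independent of the past and of each other. Under $a=0$ the next state is $(\min\{E+A,B\},K+1,C')$. Under $a=1$ the next state is $(\min\{E-E_s+A,B\},1,C')$ with probability $p(C)$ and $(\min\{E-E_s+A,B\},K+1,C')$ with probability $1-p(C)$ (independently of $A,C'$). $J^*(s)$ is the minimum over policies of $\lim_{M\to\infty}\sum_{t=0}^{M-1}\alpha^t\,\mathbb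 E[c(s(t),a(t))]$ starting from $s(0)=s$. It satisfies the Bellman equation: for $E\ge E_s$, $$J^*(E,K,C)=\min\Big\{K+\alpha\,\mathbb E_{A,C'}J^*(\min\{E+A,B\},K+1,C'),\ K(1-p(C))+\alpha p(C)\,\mathbb E_{A,C'}J^*(\min\{E-E_s+A,B\},1,C')+\alpha(1-p(C))\,\mathbb E_{A,C'}J^*(\min\{E-E_s+A,B\},K+1,C')\Big\},$$ and for $E<E_s$, $J^*(E,K,C)=K+\alpha\,\mathbb E_{A,C'}J^*(\min\{E+A,B\},K+1,C')$. The first term in the minimum is the cost of not sampling and the second the cost of sampling. Sampling is optimal in a state with $E\ge E_s$ if and only if the cost of sampling is at most the cost of not sampling. "Threshold structure on $p(C)$" means that, for $E\ge E_s$, an optimal policy samples when $p(C)\ge p_{th}(E,K)$ and does not sample otherwise; threshold values are allowed to be extended real numbers. *)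

theory Defs
  imports "HOL-Probability.Probability"
begin

datatype action = Idle | Sample

text \<open>
  A state \<open>(E, K, C)\<close> consists of the available energy, the age of information and the current
  channel state; the states proper are those with \<open>E \<le> B\<close>.  The channel states are the elements
  of the finite type \<open>'c\<close>, and the occurrence probabilities are packaged as a probability mass
  function on it.
\<close>

type_synonym 'c state = "nat \<times> nat \<times> 'c"

text \<open>
  Policies may be randomised and may depend on the whole past: the first argument is the list of
  past state-action pairs, oldest first, the second one is the current state.
\<close>

type_synonym 'c policy = "('c state \<times> action) list \<Rightarrow> 'c state \<Rightarrow> action pmf"

locale aoi_model =
  fixes B :: nat
    and Es :: nat
    and \<alpha> :: real
    and lam :: real
    and q :: "'c::finite pmf"
    and p :: "'c \<Rightarrow> real"
begin

definition state_space :: "'c state set" where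
  "state_space = {0..B} \<times> UNIV \<times> UNIV"

fun allowed :: "'c state \<Rightarrow> action set" where
  "allowed (E, K, C) = (if Es \<le> E then {Idle, Sample} else {Idle})"

fun cost :: "'c state \<Rightarrow> action \<Rightarrow> real" where
  "cost (E, K, C) Idle = real K"
| "cost (E, K, C) Sample = real K * (1 - p C)"

fun transition :: "'c state \<Rightarrow> action \<Rightarrow> 'c state pmf" where
  "transition (E, K, C) Idle =
     do {
       A \<leftarrow> bernoulli_pmf lam;
       C' \<leftarrow> q;
       return_pmf (min (E + of_bool A) B, K + 1, C')
     }"
| "transition (E, K, C) Sample =
     do {
       A \<leftarrow> bernoulli_pmf lam;
       C' \<leftarrow> q;
       success \<leftarrow> bernoulli_pmf (p C);
       return_pmf (min (E - Es + of_bool A) B, if success then 1 else K + 1, C')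
     }"

definition admissible :: "'c policy \<Rightarrow> bool" where
  "admissible \<pi> \<longleftrightarrow> (\<forall>h s. set_pmf (\<pi> h s) \<subseteq> allowed s)"

text \<open>Joint law of the past state-action pairs before time \<open>t\<close> and of the state at time \<open>t\<close>.\<close>

primrec trajectory ::
    "'c policy \<Rightarrow> 'c state \<Rightarrow> nat \<Rightarrow> (('c state \<times> action) list \<times> 'c state) pmf" where
  "trajectory \<pi> s0 0 = return_pmf ([], s0)"
| "trajectory \<pi> s0 (Suc t) =
     do {
       (h, s) \<leftarrow> trajectory \<pi> s0 t;
       a \<leftarrow> \<pi> h s;
       s' \<leftarrow> transition s a;
       return_pmf (h @ [(s, a)], s')
     }"

definition state_action :: "'c policy \<Rightarrow> 'c state \<Rightarrow> nat \<Rightarrow> ('c state \<times> action) pmf" where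
  "state_action \<pi> s0 t =
     do {
       (h, s) \<leftarrow> trajectory \<pi> s0 t;
       a \<leftarrow> \<pi> h s;
       return_pmf (s, a)
     }"

text \<open>
  Under an admissible policy every \<open>trajectory \<pi> s0 t\<close> has finite support, and the age at time
  \<open>t\<close> exceeds the initial one by at most \<open>t\<close>; so the expectations are finite and the limit
  exists for \<open>0 < \<alpha> < 1\<close>.
\<close>

definition policy_cost :: "'c policy \<Rightarrow> 'c state \<Rightarrow> real" where
  "policy_cost \<pi> s0 =
     lim (\<lambda>M. \<Sum>t<M. \<alpha> ^ t *
       measure_pmf.expectation (state_action \<pi> s0 t) (\<lambda>(s, a). cost s a))"

definition J_star :: "'c state \<Rightarrow> real" where
  "J_star s = (INF \<pi>\<in>{\<pi>. admissible \<pi>}. policy_cost \<pi> s)"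

definition optimal_policy :: "'c policy \<Rightarrow> bool" where
  "optimal_policy \<pi> \<longleftrightarrow> admissible \<pi> \<and> (\<forall>s\<in>state_space. policy_cost \<pi> s = J_star s)"

text \<open>Expectation over the energy arrival and the next channel state, which are independent.\<close>

definition expect_next :: "(bool \<Rightarrow> 'c \<Rightarrow> real) \<Rightarrow> real" where
  "expect_next f = measure_pmf.expectation (pair_pmf (bernoulli_pmf lam) q) (\<lambda>(A, C'). f A C')"

text \<open>The two terms of the minimum in the Bellman equation.\<close>

fun cost_not_sampling :: "'c state \<Rightarrow> real" where
  "cost_not_sampling (E, K, C) =
     real K + \<alpha> * expect_next (\<lambda>A C'. J_star (min (E + of_bool A) B, K + 1, C'))"

fun cost_sampling :: "'c state \<Rightarrow> real" where
  "cost_sampling (E, K, C) =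
     real K * (1 - p C)
     + \<alpha> * p C * expect_next (\<lambda>A C'. J_star (min (E - Es + of_bool A) B, 1, C'))
     + \<alpha> * (1 - p C) * expect_next (\<lambda>A C'. J_star (min (E - Es + of_bool A) B, K + 1, C'))"

definition sampling_optimal :: "'c state \<Rightarrow> bool" where
  "sampling_optimal s \<longleftrightarrow> Sample \<in> allowed s \<and> cost_sampling s \<le> cost_not_sampling s"

text \<open>A stationary deterministic policy: the same rule is applied at every time.\<close>

definition threshold_policy :: "(nat \<Rightarrow> nat \<Rightarrow> ereal) \<Rightarrow> 'c policy" where
  "threshold_policy p_th = (\<lambda>h (E, K, C).
     return_pmf (if Es \<le> E \<and> p_th E K \<le> ereal (p C) then Sample else Idle))"

end

end

theory Submission
  imports Defs
begin

text \<open>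
  Value iteration from \<open>0\<close> increases to a fixed point of the Bellman operator; it preserves
  monotonicity in the age, and the fixed point grows at most linearly in the age.  Since the age
  grows by at most one per step, the discounted fixed point along a trajectory tends to \<open>0\<close>, so a
  telescoping sum identifies it with \<open>J*\<close> and shows that every greedy policy is optimal.
  The cost of sampling minus that of idling is affine in \<open>p(C)\<close> with slope
  \<open>-(K + \<alpha> (W2 - W1))\<close>, where \<open>W1 \<le> W2\<close> are the expected optimal costs after a successful
  and a failed transmission; the slope is nonpositive, which yields the threshold.
\<close>

section \<open>Expectations over finitely supported distributions\<close>

lemma expectation_bind_pmf_finite:
  fixes f :: "'b \<Rightarrow> real"
  assumes "finite (set_pmf M)" and "\<And>x. x \<in> set_pmf M \<Longrightarrow> finite (set_pmf (N x))"
  shows "measure_pmf.expectation (bind_pmf M N) f =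
         measure_pmf.expectation M (\<lambda>x. measure_pmf.expectation (N x) f)"
  using assms
  by (subst pmf_expectation_bind[where A = "set_pmf M"])
     (auto simp: integral_measure_pmf[where A = "set_pmf M"])

lemma expectation_mono_finite:
  fixes f g :: "'a \<Rightarrow> real"
  assumes "finite (set_pmf M)" and "\<And>x. x \<in> set_pmf M \<Longrightarrow> f x \<le> g x"
  shows "measure_pmf.expectation M f \<le> measure_pmf.expectation M g"
  using assms by (auto intro!: sum_mono mult_left_mono simp: integral_measure_pmf[where A = "set_pmf M"])

lemma tendsto_expectation_finite:
  fixes f :: "'b \<Rightarrow> 'a \<Rightarrow> real"
  assumes "finite (set_pmf M)" and "\<And>x. x \<in> set_pmf M \<Longrightarrow> ((\<lambda>n. f n x) \<longlongrightarrow> g x) F"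
  shows "((\<lambda>n. measure_pmf.expectation M (f n)) \<longlongrightarrow> measure_pmf.expectation M g) F"
  using assms by (auto intro!: tendsto_intros simp: integral_measure_pmf[where A = "set_pmf M"])

lemma finite_set_action_pmf [simp]: "finite (set_pmf (M :: action pmf))"
proof (rule finite_subset)
  show "set_pmf M \<subseteq> {Idle, Sample}"
    using action.exhaust by blast
qed simp

section \<open>One-step transitions, costs and ages\<close>

locale aoi_mdp = aoi_model B Es \<alpha> lam q p
  for B Es :: nat and \<alpha> lam :: real and q :: "'c::finite pmf" and p :: "'c \<Rightarrow> real" +
  assumes alpha_pos: "0 < \<alpha>" and alpha_less_1: "\<alpha> < 1"
    and p_nonneg: "0 \<le> p C" and p_le_1: "p C \<le> 1"
begin

lemma finite_set_pmf_transition [simp]: "finite (set_pmf (transition s a))"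
  by (cases s; cases a) auto

lemma expectation_transition_Idle:
  "measure_pmf.expectation (transition (E, K, C) Idle) f =
   expect_next (\<lambda>A C'. f (min (E + of_bool A) B, K + 1, C'))"
  by (simp add: expect_next_def pair_pmf_def expectation_bind_pmf_finite)

text \<open>Integrating out the success bit leaves two expectations over energy arrival and channel
  only, which is the shape of \<open>cost_sampling\<close>.\<close>

lemma expectation_transition_Sample:
  "measure_pmf.expectation (transition (E, K, C) Sample) f =
   p C * expect_next (\<lambda>A C'. f (min (E - Es + of_bool A) B, 1, C')) +
   (1 - p C) * expect_next (\<lambda>A C'. f (min (E - Es + of_bool A) B, K + 1, C'))"
proof -
  let ?b = "\<lambda>A k C'. f (min (E - Es + of_bool A) B, k, C')"
  have "measure_pmf.expectation (transition (E, K, C) Sample) f =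
        measure_pmf.expectation (bernoulli_pmf lam) (\<lambda>A. measure_pmf.expectation q
          (\<lambda>C'. p C * ?b A 1 C' + (1 - p C) * ?b A (K + 1) C'))"
    using p_nonneg[of C] p_le_1[of C]
    by (simp add: expectation_bind_pmf_finite algebra_simps)
  also have "\<dots> = p C * expect_next (\<lambda>A. ?b A 1) + (1 - p C) * expect_next (\<lambda>A. ?b A (K + 1))"
    by (simp add: expect_next_def pair_pmf_def expectation_bind_pmf_finite
        integrable_measure_pmf_finite)
  finally show ?thesis .
qed

lemma age_transition_le: "s' \<in> set_pmf (transition s a) \<Longrightarrow> fst (snd s') \<le> fst (snd s) + 1"
  by (cases s; cases a) (auto split: if_splits)

lemma cost_nonneg: "0 \<le> cost s a"
  using p_le_1 by (cases s; cases a) auto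

lemma cost_le: "cost s a \<le> real (fst (snd s))"
  using p_nonneg p_le_1 by (cases s; cases a) (auto intro: mult_left_le)

lemma expect_next_mono: "(\<And>A C'. f A C' \<le> g A C') \<Longrightarrow> expect_next f \<le> expect_next g"
  unfolding expect_next_def by (rule expectation_mono_finite) auto

section \<open>State-action values and the Bellman operator\<close>

definition action_value :: "('c state \<Rightarrow> real) \<Rightarrow> 'c state \<Rightarrow> action \<Rightarrow> real" where
  "action_value V s a = cost s a + \<alpha> * measure_pmf.expectation (transition s a) V"

definition bellman :: "('c state \<Rightarrow> real) \<Rightarrow> 'c state \<Rightarrow> real" where
  "bellman V s = (if Sample \<in> allowed s then min (action_value V s Idle) (action_value V s Sample)
                  else action_value V s Idle)"

lemma action_value_mono:
  assumes "\<And>s. U s \<le> V s"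
  shows "action_value U s a \<le> action_value V s a"
  using alpha_pos assms by (auto simp: action_value_def intro!: mult_left_mono expectation_mono_finite)

lemma bellman_mono: "(\<And>s. U s \<le> V s) \<Longrightarrow> bellman U s \<le> bellman V s"
  unfolding bellman_def using action_value_mono[of U V s] by (auto intro: min.coboundedI1 min.coboundedI2)

lemma bellman_le_action_value: "a \<in> allowed s \<Longrightarrow> bellman V s \<le> action_value V s a"
  by (cases a) (auto simp: bellman_def)

text \<open>The allowed actions depend on the energy alone, so the minima can be compared action by
  action. A larger age raises the stage cost and the age after idling or a failure; after a success
  the age is 1 in both cases.\<close>

lemma bellman_mono_age:
  assumes V: "\<And>E K K' C. K \<le> K' \<Longrightarrow> V (E, K, C) \<le> V (E, K', C)" and K: "K \<le> K'"
  shows "bellman V (E, K, C) \<le> bellman V (E, K', C)"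
proof -
  have "action_value V (E, K, C) a \<le> action_value V (E, K', C) a" for a
  proof (cases a)
    case Idle
    then show ?thesis
      unfolding action_value_def Idle expectation_transition_Idle using alpha_pos K
      by (auto intro!: add_mono mult_left_mono expect_next_mono V)
  next
    case Sample
    then show ?thesis
      unfolding action_value_def Sample expectation_transition_Sample
      using alpha_pos K p_nonneg p_le_1
      by (auto intro!: add_mono mult_left_mono mult_right_mono expect_next_mono V)
  qed
  then show ?thesis
    by (auto simp: bellman_def intro: min.coboundedI1 min.coboundedI2)
qed

section \<open>Value iteration and its limit\<close>

primrec value_iter :: "nat \<Rightarrow> 'c state \<Rightarrow> real" where
  "value_iter 0 = (\<lambda>s. 0)"
| "value_iter (Suc n) = bellman (value_iter n)"

text \<open>Nonnegative costs give the first inequality, and monotonicity of the Bellman operator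
  propagates it.\<close>

lemma value_iter_Suc_ge: "value_iter n s \<le> value_iter (Suc n) s"
proof (induction n arbitrary: s)
  case 0
  then show ?case
    using cost_nonneg by (simp add: bellman_def action_value_def)
next
  case (Suc n)
  then show ?case
    by (simp only: value_iter.simps) (rule bellman_mono, simp)
qed

lemma value_iter_incseq: "incseq (\<lambda>n. value_iter n s)"
  by (rule incseq_SucI) (rule value_iter_Suc_ge)

lemma value_iter_mono_age: "K \<le> K' \<Longrightarrow> value_iter n (E, K, C) \<le> value_iter n (E, K', C)"
  by (induction n arbitrary: E K K' C) (simp_all add: bellman_mono_age)

text \<open>The cost of never sampling, in closed form.\<close>

definition idle_cost :: "'c state \<Rightarrow> real" where
  "idle_cost s = real (fst (snd s)) / (1 - \<alpha>) + \<alpha> / (1 - \<alpha>)\<^sup>2"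

text \<open>Splitting off the first term of the sum of \<open>\<alpha> ^ t * (K + t)\<close>
  suggests this equation. It makes \<open>idle_cost\<close> a fixed point under idling, hence an
  upper bound for its own Bellman update.\<close>

lemma idle_cost_eq: "action_value idle_cost (E, K, C) Idle = idle_cost (E, K, C)"
proof -
  \<comment> \<open>Writing \<open>u\<close> for \<open>1 - \<alpha>\<close> turns the claim into a
    rational identity with a single nonzero denominator.\<close>
  have "x + (1 - u) * ((x + 1) / u + (1 - u) / u\<^sup>2) = x / u + (1 - u) / u\<^sup>2"
    if "u \<noteq> 0" for x u :: real
    using that by (simp add: field_simps power2_eq_square)
  from this[of "1 - \<alpha>" "real K"] show ?thesis
    using alpha_less_1
    unfolding action_value_def expectation_transition_Idle expect_next_def idle_cost_def
    by (simp add: split_def add.commute)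
qed

text \<open>Idling is always allowed, so a Bellman step is at most the value of idling, for which
  \<open>idle_cost\<close> is stationary.\<close>

lemma value_iter_le: "value_iter n s \<le> idle_cost s"
proof (induction n arbitrary: s)
  case 0
  then show ?case
    using alpha_pos alpha_less_1 by (simp add: idle_cost_def)
next
  case (Suc n)
  have "bellman (value_iter n) s \<le> action_value (value_iter n) s Idle"
    by (rule bellman_le_action_value) (cases s, simp)
  also have "\<dots> \<le> action_value idle_cost s Idle"
    by (rule action_value_mono) (rule Suc)
  also have "\<dots> = idle_cost s"
    by (cases s) (simp add: idle_cost_eq)
  finally show ?case by simp
qed

text \<open>The real supremum is meaningful because \<open>value_iter_le\<close> bounds the iterates
  at each state.\<close>

definition opt_value :: "'c state \<Rightarrow> real" where
  "opt_value s = (SUP n. value_iter n s)"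

lemma value_iter_tendsto: "(\<lambda>n. value_iter n s) \<longlonglongrightarrow> opt_value s"
  unfolding opt_value_def
  by (rule LIMSEQ_incseq_SUP) (auto intro!: bdd_aboveI2 value_iter_le value_iter_incseq)

lemma opt_value_nonneg: "0 \<le> opt_value s"
  using incseq_le[OF value_iter_incseq value_iter_tendsto, of 0 s] by simp

lemma opt_value_le: "opt_value s \<le> idle_cost s"
  by (rule LIMSEQ_le_const2[OF value_iter_tendsto]) (auto intro: value_iter_le)

lemma opt_value_mono_age: "K \<le> K' \<Longrightarrow> opt_value (E, K, C) \<le> opt_value (E, K', C)"
  by (rule LIMSEQ_le[OF value_iter_tendsto value_iter_tendsto]) (auto intro: value_iter_mono_age)

text \<open>The Bellman operator respects pointwise limits: it is built from finite expectations and
  a minimum of two terms.\<close>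

lemma bellman_opt_value: "bellman opt_value s = opt_value s"
proof (rule LIMSEQ_unique)
  show "(\<lambda>n. value_iter (Suc n) s) \<longlonglongrightarrow> opt_value s"
    using value_iter_tendsto by (rule LIMSEQ_Suc)
  show "(\<lambda>n. value_iter (Suc n) s) \<longlonglongrightarrow> bellman opt_value s"
    unfolding value_iter.simps bellman_def action_value_def
    by (auto intro!: tendsto_intros tendsto_expectation_finite value_iter_tendsto)
qed

section \<open>Trajectories and convergence of the discounted cost\<close>

lemma finite_set_pmf_trajectory [simp]: "finite (set_pmf (trajectory \<pi> s0 t))"
  by (induction t) (auto simp: split_def)

lemma finite_set_pmf_state_action [simp]: "finite (set_pmf (state_action \<pi> s0 t))"
  by (auto simp: state_action_def split_def)

lemma age_trajectory_le:
  "x \<in> set_pmf (trajectory \<pi> s0 t) \<Longrightarrow> fst (snd (snd x)) \<le> fst (snd s0) + t"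
proof (induction t arbitrary: x)
  case (Suc t)
  then obtain h s a s' where "(h, s) \<in> set_pmf (trajectory \<pi> s0 t)"
      "s' \<in> set_pmf (transition s a)" "x = (h @ [(s, a)], s')"
    by auto
  with Suc.IH[of "(h, s)"] age_transition_le[of s' s a] show ?case by simp
qed simp

definition stage_cost :: "'c policy \<Rightarrow> 'c state \<Rightarrow> nat \<Rightarrow> real" where
  "stage_cost \<pi> s0 t = measure_pmf.expectation (state_action \<pi> s0 t) (\<lambda>(s, a). cost s a)"

lemma stage_cost_nonneg: "0 \<le> stage_cost \<pi> s0 t"
  unfolding stage_cost_def by (rule Bochner_Integration.integral_nonneg) (auto simp: cost_nonneg)

lemma stage_cost_le: "stage_cost \<pi> s0 t \<le> real (fst (snd s0) + t)"
proof -
  have "(case x of (s, a) \<Rightarrow> cost s a) \<le> real (fst (snd s0) + t)"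
    if "x \<in> set_pmf (state_action \<pi> s0 t)" for x
  proof -
    from that obtain h s a where "(h, s) \<in> set_pmf (trajectory \<pi> s0 t)" "x = (s, a)"
      by (auto simp: state_action_def)
    with age_trajectory_le[of "(h, s)" \<pi> s0 t] cost_le[of s a] show ?thesis by simp
  qed
  then have "stage_cost \<pi> s0 t \<le>
      measure_pmf.expectation (state_action \<pi> s0 t) (\<lambda>_. real (fst (snd s0) + t))"
    unfolding stage_cost_def by (intro expectation_mono_finite) auto
  then show ?thesis by simp
qed

lemma discounted_age_tendsto_0: "(\<lambda>t. \<alpha> ^ t * real (k + t)) \<longlonglongrightarrow> 0"
proof -
  have "(\<lambda>t. real k * \<alpha> ^ t + real t * \<alpha> ^ t) \<longlonglongrightarrow> real k * 0 + 0"
    using alpha_pos alpha_less_1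
    by (intro tendsto_intros LIMSEQ_power_zero powser_times_n_limit_0) auto
  then show ?thesis by (simp add: algebra_simps)
qed

text \<open>Since \<open>policy_cost\<close> is defined by \<open>lim\<close>, convergence has to be
  established first; it follows by comparison with an arithmetic-geometric series.\<close>

lemma policy_cost_tendsto:
  "(\<lambda>M. \<Sum>t<M. \<alpha> ^ t * stage_cost \<pi> s0 t) \<longlonglongrightarrow> policy_cost \<pi> s0"
proof -
  have "summable (\<lambda>t. \<alpha> ^ t * real (fst (snd s0) + t))"
  proof -
    \<comment> \<open>The factor \<open>K + t\<close> is split as \<open>(t + 1) + (K - 1)\<close>:
      the derivative of the geometric series plus a multiple of the series itself.\<close>
    have "summable (\<lambda>t. real (Suc t) * \<alpha> ^ t + (real (fst (snd s0)) - 1) * \<alpha> ^ t)"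
      using alpha_pos alpha_less_1 sums_summable[OF geometric_deriv_sums[of \<alpha>]]
      by (intro summable_add summable_mult summable_geometric) auto
    then show ?thesis by (simp add: algebra_simps)
  qed
  then have "summable (\<lambda>t. \<alpha> ^ t * stage_cost \<pi> s0 t)"
  proof (rule summable_comparison_test'[where N = 0])
    fix t :: nat
    show "norm (\<alpha> ^ t * stage_cost \<pi> s0 t) \<le> \<alpha> ^ t * real (fst (snd s0) + t)"
      using mult_left_mono[OF stage_cost_le[of \<pi> s0 t], of "\<alpha> ^ t"]
        stage_cost_nonneg[of \<pi> s0 t] alpha_pos
      by (simp add: abs_mult del: of_nat_add)
  qed
  then have "(\<lambda>M. \<Sum>t<M. \<alpha> ^ t * stage_cost \<pi> s0 t) \<longlonglongrightarrow> (\<Sum>t. \<alpha> ^ t * stage_cost \<pi> s0 t)"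
    by (rule summable_LIMSEQ)
  then show ?thesis
    unfolding policy_cost_def stage_cost_def[symmetric] by (simp add: limI)
qed

section \<open>Telescoping the fixed point along a trajectory\<close>

definition terminal_value :: "'c policy \<Rightarrow> 'c state \<Rightarrow> nat \<Rightarrow> real" where
  "terminal_value \<pi> s0 t = measure_pmf.expectation (trajectory \<pi> s0 t) (\<lambda>(h, s). opt_value s)"

text \<open>The bound \<open>idle_cost\<close> is linear in the age, and the age grows at most
  linearly in time, so the discount factor wins.\<close>

lemma terminal_value_tendsto_0: "(\<lambda>t. \<alpha> ^ t * terminal_value \<pi> s0 t) \<longlonglongrightarrow> 0"
proof (rule tendsto_sandwich)
  have "terminal_value \<pi> s0 t \<le> real (fst (snd s0) + t) / (1 - \<alpha>) + \<alpha> / (1 - \<alpha>)\<^sup>2" for t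
  proof -
    have "terminal_value \<pi> s0 t \<le> measure_pmf.expectation (trajectory \<pi> s0 t)
        (\<lambda>_. real (fst (snd s0) + t) / (1 - \<alpha>) + \<alpha> / (1 - \<alpha>)\<^sup>2)"
      unfolding terminal_value_def
    proof (rule expectation_mono_finite)
      fix x assume x: "x \<in> set_pmf (trajectory \<pi> s0 t)"
      have "opt_value (snd x) \<le> idle_cost (snd x)" by (rule opt_value_le)
      also have "\<dots> \<le> real (fst (snd s0) + t) / (1 - \<alpha>) + \<alpha> / (1 - \<alpha>)\<^sup>2"
        unfolding idle_cost_def using age_trajectory_le[OF x] alpha_less_1
        by (intro add_mono divide_right_mono of_nat_mono) auto
      finally show "(case x of (h, s) \<Rightarrow> opt_value s) \<le>
          real (fst (snd s0) + t) / (1 - \<alpha>) + \<alpha> / (1 - \<alpha>)\<^sup>2"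
        by (simp add: split_def)
    qed simp
    then show ?thesis by simp
  qed
  then show "\<forall>\<^sub>F t in sequentially. \<alpha> ^ t * terminal_value \<pi> s0 t \<le>
      \<alpha> ^ t * (real (fst (snd s0) + t) / (1 - \<alpha>) + \<alpha> / (1 - \<alpha>)\<^sup>2)"
    using alpha_pos by (intro always_eventually allI mult_left_mono) auto
  show "\<forall>\<^sub>F t in sequentially. 0 \<le> \<alpha> ^ t * terminal_value \<pi> s0 t"
    unfolding terminal_value_def using alpha_pos opt_value_nonneg
    by (intro always_eventually allI mult_nonneg_nonneg Bochner_Integration.integral_nonneg) auto
  have "(\<lambda>t. (\<alpha> ^ t * real (fst (snd s0) + t)) / (1 - \<alpha>) + \<alpha> ^ t * (\<alpha> / (1 - \<alpha>)\<^sup>2))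
      \<longlonglongrightarrow> 0 / (1 - \<alpha>) + 0 * (\<alpha> / (1 - \<alpha>)\<^sup>2)"
    using alpha_pos alpha_less_1
    by (intro tendsto_intros discounted_age_tendsto_0 LIMSEQ_power_zero) auto
  then show "(\<lambda>t. \<alpha> ^ t * (real (fst (snd s0) + t) / (1 - \<alpha>) + \<alpha> / (1 - \<alpha>)\<^sup>2)) \<longlonglongrightarrow> 0"
    by (simp add: ring_distribs)
qed simp

text \<open>Conditioning on the trajectory up to time \<open>t\<close> and then on the action merges
  the current cost and the discounted continuation into one state-action value.\<close>

lemma stage_cost_plus_terminal_value:
  "stage_cost \<pi> s0 t + \<alpha> * terminal_value \<pi> s0 (Suc t) =
   measure_pmf.expectation (trajectory \<pi> s0 t)
     (\<lambda>(h, s). measure_pmf.expectation (\<pi> h s) (action_value opt_value s))"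
proof -
  let ?T = "trajectory \<pi> s0 t"
  have "stage_cost \<pi> s0 t =
      measure_pmf.expectation ?T (\<lambda>x. measure_pmf.expectation (\<pi> (fst x) (snd x)) (cost (snd x)))"
    by (simp add: stage_cost_def state_action_def split_def expectation_bind_pmf_finite)
  moreover have "terminal_value \<pi> s0 (Suc t) =
      measure_pmf.expectation ?T (\<lambda>x. measure_pmf.expectation (\<pi> (fst x) (snd x))
        (\<lambda>a. measure_pmf.expectation (transition (snd x) a) opt_value))"
    by (simp add: terminal_value_def split_def expectation_bind_pmf_finite)
  moreover have "action_value opt_value s =
      (\<lambda>a. cost s a + \<alpha> * measure_pmf.expectation (transition s a) opt_value)" for s
    by (rule ext) (rule action_value_def)
  ultimately show ?thesis
    by (simp add: split_def integrable_measure_pmf_finite)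
qed

lemma terminal_value_telescope:
  "(\<Sum>t<M. \<alpha> ^ t * (stage_cost \<pi> s0 t + \<alpha> * terminal_value \<pi> s0 (Suc t) - terminal_value \<pi> s0 t)) =
   (\<Sum>t<M. \<alpha> ^ t * stage_cost \<pi> s0 t) + \<alpha> ^ M * terminal_value \<pi> s0 M - opt_value s0"
proof (induction M)
  case 0
  then show ?case by (simp add: terminal_value_def)
next
  case (Suc M)
  then show ?case unfolding sum.lessThan_Suc by (simp add: algebra_simps)
qed

text \<open>The gap between a policy's cost and the fixed point is the discounted sum of its
  one-step Bellman losses; the boundary term vanishes in the limit.\<close>

lemma policy_cost_sums:
  "(\<lambda>t. \<alpha> ^ t * (stage_cost \<pi> s0 t + \<alpha> * terminal_value \<pi> s0 (Suc t) - terminal_value \<pi> s0 t))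
     sums (policy_cost \<pi> s0 - opt_value s0)"
proof -
  have "(\<lambda>M. (\<Sum>t<M. \<alpha> ^ t * stage_cost \<pi> s0 t) + \<alpha> ^ M * terminal_value \<pi> s0 M - opt_value s0)
      \<longlonglongrightarrow> policy_cost \<pi> s0 + 0 - opt_value s0"
    by (intro tendsto_intros policy_cost_tendsto terminal_value_tendsto_0)
  then show ?thesis
    by (simp add: sums_def terminal_value_telescope)
qed

text \<open>Each Bellman loss is nonnegative: any allowed action has value at least the minimum, and
  averaging over a randomised, history-dependent choice keeps the inequality.\<close>

lemma opt_value_le_policy_cost:
  assumes "admissible \<pi>"
  shows "opt_value s0 \<le> policy_cost \<pi> s0"
proof -
  have "terminal_value \<pi> s0 t \<le> stage_cost \<pi> s0 t + \<alpha> * terminal_value \<pi> s0 (Suc t)" for t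
    unfolding stage_cost_plus_terminal_value unfolding terminal_value_def
  proof (rule expectation_mono_finite)
    fix x assume "x \<in> set_pmf (trajectory \<pi> s0 t)"
    obtain h s where x: "x = (h, s)" by (cases x)
    have "opt_value s = measure_pmf.expectation (\<pi> h s) (\<lambda>_. opt_value s)" by simp
    also have "\<dots> \<le> measure_pmf.expectation (\<pi> h s) (action_value opt_value s)"
    proof (rule expectation_mono_finite)
      fix a assume "a \<in> set_pmf (\<pi> h s)"
      then have "a \<in> allowed s"
        using assms unfolding admissible_def by blast
      then show "opt_value s \<le> action_value opt_value s a"
        using bellman_le_action_value[of a s opt_value] by (simp add: bellman_opt_value)
    qed simp
    finally show "(case x of (h, s) \<Rightarrow> opt_value s) \<le>
        (case x of (h, s) \<Rightarrow> measure_pmf.expectation (\<pi> h s) (action_value opt_value s))"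
      by (simp add: x)
  qed simp
  then have "0 \<le> policy_cost \<pi> s0 - opt_value s0"
    using alpha_pos by (intro sums_le[OF _ sums_zero policy_cost_sums]) simp
  then show ?thesis by simp
qed

text \<open>A rule attaining the Bellman minimum in every state has zero loss at every step, so the
  gap is zero.\<close>

lemma policy_cost_greedy:
  assumes "\<And>h s. \<pi> h s = return_pmf (d s)" and "\<And>s. action_value opt_value s (d s) = opt_value s"
  shows "policy_cost \<pi> s0 = opt_value s0"
proof -
  have "stage_cost \<pi> s0 t + \<alpha> * terminal_value \<pi> s0 (Suc t) = terminal_value \<pi> s0 t" for t
    unfolding stage_cost_plus_terminal_value by (simp add: assms terminal_value_def)
  then have "(\<lambda>t. 0) sums (policy_cost \<pi> s0 - opt_value s0)"
    using policy_cost_sums[of \<pi> s0] by simp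
  then show ?thesis
    using sums_unique2[OF _ sums_zero] by fastforce
qed

section \<open>The optimal cost and its greedy policies\<close>

lemma J_star_eq_opt_value: "J_star = opt_value"
proof
  fix s
  \<comment> \<open>The greedy rule shows that the infimum is attained. Ties go to
    \<open>Sample\<close>, as in \<open>sampling_optimal\<close>.\<close>
  define d where "d s = (if Sample \<in> allowed s \<and>
    action_value opt_value s Sample \<le> action_value opt_value s Idle then Sample else Idle)" for s
  define \<pi> :: "'c policy" where "\<pi> = (\<lambda>h s. return_pmf (d s))"
  have "action_value opt_value s (d s) = opt_value s" for s
    using bellman_opt_value[of s] by (auto simp: d_def bellman_def min_def split: if_splits)
  then have cost: "policy_cost \<pi> s = opt_value s"
    by (intro policy_cost_greedy[where d = d]) (auto simp: \<pi>_def)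
  have adm: "admissible \<pi>"
    by (auto simp: admissible_def \<pi>_def d_def)
  show "J_star s = opt_value s"
    unfolding J_star_def
  proof (rule cInf_eq_minimum)
    show "opt_value s \<in> (\<lambda>\<pi>. policy_cost \<pi> s) ` {\<pi>. admissible \<pi>}"
      using cost adm by force
  qed (auto intro: opt_value_le_policy_cost)
qed

text \<open>This and the next lemma turn the two Bellman terms into state-action values, so that
  \<open>sampling_optimal\<close> is seen to select a minimiser.\<close>

lemma cost_not_sampling_eq: "cost_not_sampling s = action_value opt_value s Idle"
  by (cases s) (simp add: action_value_def expectation_transition_Idle J_star_eq_opt_value
      del: transition.simps)

lemma cost_sampling_eq: "cost_sampling s = action_value opt_value s Sample"
  by (cases s) (simp add: action_value_def expectation_transition_Sample J_star_eq_opt_value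
      algebra_simps del: transition.simps)

lemma optimal_policy_greedy:
  assumes "\<And>h s. \<pi> h s = return_pmf (if sampling_optimal s then Sample else Idle)"
  shows "optimal_policy \<pi>"
proof -
  have "action_value opt_value s (if sampling_optimal s then Sample else Idle) = opt_value s" for s
    using bellman_opt_value[of s]
    by (auto simp: sampling_optimal_def cost_sampling_eq cost_not_sampling_eq bellman_def min_def
        split: if_splits)
  then have "policy_cost \<pi> s = J_star s" for s
    using policy_cost_greedy[OF assms] by (simp add: J_star_eq_opt_value)
  moreover have "admissible \<pi>"
    by (auto simp: admissible_def assms sampling_optimal_def)
  ultimately show ?thesis
    by (simp add: optimal_policy_def)
qed

section \<open>The threshold in the success probability\<close>

lemma sampling_optimal_threshold:
  obtains p_th :: "nat \<Rightarrow> nat \<Rightarrow> ereal"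
  where "\<And>E K C. Es \<le> E \<Longrightarrow> sampling_optimal (E, K, C) \<longleftrightarrow> p_th E K \<le> ereal (p C)"
proof -
  have "\<exists>th :: ereal. \<forall>C. Es \<le> E \<longrightarrow> (sampling_optimal (E, K, C) \<longleftrightarrow> th \<le> ereal (p C))" for E K
  proof -
    define W0 where "W0 = expect_next (\<lambda>A C'. J_star (min (E + of_bool A) B, K + 1, C'))"
    define W1 where "W1 = expect_next (\<lambda>A C'. J_star (min (E - Es + of_bool A) B, 1, C'))"
    define W2 where "W2 = expect_next (\<lambda>A C'. J_star (min (E - Es + of_bool A) B, K + 1, C'))"
    \<comment> \<open>With these abbreviations, sampling minus idling costs
      \<open>\<alpha> * (W2 - W0) - p C * D\<close>, where only \<open>p C\<close> depends on the
      channel.\<close>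
    define D where "D = real K + \<alpha> * (W2 - W1)"
    have "W1 \<le> W2"
      unfolding W1_def W2_def J_star_eq_opt_value by (intro expect_next_mono opt_value_mono_age) simp
    then have "0 \<le> D"
      using alpha_pos by (simp add: D_def)
    have *: "sampling_optimal (E, K, C) \<longleftrightarrow> \<alpha> * (W2 - W0) \<le> p C * D" if "Es \<le> E" for C
      using that unfolding sampling_optimal_def cost_sampling.simps cost_not_sampling.simps
        W0_def[symmetric] W1_def[symmetric] W2_def[symmetric] D_def
      by (auto simp: algebra_simps)
    show ?thesis
    \<comment> \<open>\<open>D = 0\<close> occurs exactly at \<open>K = 0\<close>, where success and
      failure both lead to age 1. The comparison then ignores the channel, so the threshold is
      infinite: \<open>-\<infinity>\<close> for always sampling, \<open>\<infinity>\<close> for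
      never.\<close>
    proof (cases "D = 0")
      case True
      then show ?thesis
        using * by (intro exI[of _ "if \<alpha> * (W2 - W0) \<le> 0 then -\<infinity> else \<infinity>"]) auto
    next
      case False
      with \<open>0 \<le> D\<close> show ?thesis
        using * by (intro exI[of _ "ereal (\<alpha> * (W2 - W0) / D)"]) (simp add: divide_le_eq)
    qed
  qed
  then show ?thesis
    using that by metis
qed

end

theorem theorem1:
  fixes B Es :: nat
    and \<alpha> lam :: real
    and q :: "'c::finite pmf"
    and p :: "'c \<Rightarrow> real"
  assumes "1 \<le> B" and "1 \<le> Es"
    and "0 < \<alpha>" and "\<alpha> < 1"
    and "0 < lam" and "lam \<le> 1"
    and "\<And>C. 0 \<le> p C" and "\<And>C. p C \<le> 1"
  shows "\<exists>p_th :: nat \<Rightarrow> nat \<Rightarrow> ereal.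
           (\<forall>E K C. (E, K, C) \<in> aoi_model.state_space B \<and> Es \<le> E \<longrightarrow>
              (aoi_model.sampling_optimal B Es \<alpha> lam q p (E, K, C) \<longleftrightarrow> p_th E K \<le> ereal (p C))) \<and>
           aoi_model.optimal_policy B Es \<alpha> lam q p (aoi_model.threshold_policy Es p p_th)"
proof -
  interpret aoi_mdp B Es \<alpha> lam q p
    by unfold_locales (use assms in auto)
  obtain p_th :: "nat \<Rightarrow> nat \<Rightarrow> ereal" where
    p_th: "\<And>E K C. Es \<le> E \<Longrightarrow> sampling_optimal (E, K, C) \<longleftrightarrow> p_th E K \<le> ereal (p C)"
    using sampling_optimal_threshold by blast
  have "threshold_policy p_th h s = return_pmf (if sampling_optimal s then Sample else Idle)" for h s
  proof -
    obtain E K C where s: "s = (E, K, C)" by (cases s)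
    \<comment> \<open>Below \<open>Es\<close> both sides are false, since
      \<open>sampling_optimal\<close> requires \<open>Sample\<close> to be allowed; hence the
      policies agree in every state.\<close>
    have "sampling_optimal s \<longleftrightarrow> Es \<le> E \<and> p_th E K \<le> ereal (p C)"
      using p_th[of E K C] by (auto simp: s sampling_optimal_def split: if_splits)
    then show ?thesis by (simp add: threshold_policy_def s)
  qed
  then have "optimal_policy (threshold_policy p_th)"
    by (rule optimal_policy_greedy)
  with p_th show ?thesis by blast
qed

end
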